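(* Given constants $l,K>0$, $x\in[0,l]$, $v\in\mathbb{R}$, and a standard one-dimensional Brownian motion $B(t)$ with $B(0)=0$, there exist unique processes $L_0(t)$ and $L_l(t)$, $t\ge 0$, satisfying: 1. $Y_0(t)\le X(t)\le Y_l(t)$ for all $t\geq 0$, where (a) $X(t)= x+B(t)+L_0(t)-L_l(t)$, (b) $V(t)= v-K(L_0(t)-L_l(t))$, (c) $Y_0(t)= \int_0^t V(s)\,ds$, (d) $Y_l(t)= Y_0(t)+l$; 2. $L_0(t)$ and $L_l(t)$ are continuous, nondecreasing functions, with $L_0(0)=L_l(0)=0$; 3. $L_0(t)$ and $L_l(t)$ are flat off the sets $\{t:Y_0(t)=X(t)\}$ and $\{t:Y_l(t)=X(t)\}$, respectively.
   Context: A nondecreasing continuous function $L$ is flat off a closed set $S$ if $\int_0^\infty 1_{\{s\notin S\}}\,dL(s)=0$. Existence and uniqueness are pathwise (almost surely). *)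

theory Defs
  imports "HOL-Probability.Probability"
begin

text \<open>Processes are indexed by \<^typ>\<open>real\<close>, but only times \<open>t \<ge> 0\<close> are meaningful; nothing is
  required of a process or a path at negative times.\<close>

definition standard_brownian_motion :: "'a measure \<Rightarrow> (real \<Rightarrow> 'a \<Rightarrow> real) \<Rightarrow> bool" where
  "standard_brownian_motion M B \<longleftrightarrow>
     prob_space M \<and>
     (\<forall>t\<ge>0. B t \<in> borel_measurable M) \<and>
     (AE \<omega> in M. B 0 \<omega> = 0) \<and>
     (AE \<omega> in M. continuous_on {0..} (\<lambda>t. B t \<omega>)) \<and>
     (\<forall>s t. 0 \<le> s \<and> s < t \<longrightarrow>
        distributed M lborel (\<lambda>\<omega>. B t \<omega> - B s \<omega>) (normal_density 0 (sqrt (t - s)))) \<and>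
     (\<forall>(n::nat) \<tau>. 0 \<le> \<tau> 0 \<and> (\<forall>i<n. \<tau> i < \<tau> (Suc i)) \<longrightarrow>
        prob_space.indep_vars M (\<lambda>_. borel) (\<lambda>i \<omega>. B (\<tau> (Suc i)) \<omega> - B (\<tau> i) \<omega>) {..<n})"

text \<open>The integral of the indicator of the complement of \<open>S\<close> over \<open>[0, \<infinity>)\<close> with respect to \<open>dL\<close>.
  The Stieltjes measure \<^const>\<open>interval_measure\<close> needs an integrator on the whole line, so \<open>L\<close> is
  extended to negative times by the constant \<open>L 0\<close>, which adds no mass. The notion is meant for
  \<open>L\<close> continuous and nondecreasing on \<open>[0, \<infinity>)\<close> and \<open>S\<close> closed.\<close>

definition flat_off :: "(real \<Rightarrow> real) \<Rightarrow> real set \<Rightarrow> bool" where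
  "flat_off L S \<longleftrightarrow>
     (\<integral>\<^sup>+ s\<in>{0..}. indicator (- S) s \<partial>(interval_measure (\<lambda>s. L (max 0 s)))) = 0"

text \<open>Here \<open>b\<close>, \<open>L0\<close>, \<open>Ll\<close> are single paths. The last two conditions are stated after continuity and
  monotonicity, which (for continuous \<open>b\<close>) make the contact sets closed and the Stieltjes
  measures in \<^const>\<open>flat_off\<close> the intended ones.\<close>

definition reflection_solution ::
  "real \<Rightarrow> real \<Rightarrow> real \<Rightarrow> real \<Rightarrow> (real \<Rightarrow> real) \<Rightarrow> (real \<Rightarrow> real) \<Rightarrow> (real \<Rightarrow> real) \<Rightarrow> bool" where
  "reflection_solution l K x v b L0 Ll \<longleftrightarrow>
     (let X = (\<lambda>t. x + b t + L0 t - Ll t);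
          V = (\<lambda>t. v - K * (L0 t - Ll t));
          Y0 = (\<lambda>t. integral {0..t} V);
          Yl = (\<lambda>t. Y0 t + l)
      in (\<forall>t\<ge>0. Y0 t \<le> X t \<and> X t \<le> Yl t) \<and>
         continuous_on {0..} L0 \<and> mono_on {0..} L0 \<and> L0 0 = 0 \<and>
         continuous_on {0..} Ll \<and> mono_on {0..} Ll \<and> Ll 0 = 0 \<and>
         flat_off L0 {t. 0 \<le> t \<and> Y0 t = X t} \<and>
         flat_off Ll {t. 0 \<le> t \<and> Yl t = X t})"

end

theory Submission
  imports Defs
begin

text \<open>The argument is pathwise, for a continuous path of \<open>B\<close> that starts at \<open>0\<close>. Put
\<open>w t = x + B t - v t\<close> and \<open>D = L\<^sub>0 - L\<^sub>l\<close>. Then \<open>Z = X - Y\<^sub>0\<close> satisfies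
\<open>Z = w + D + K * \<integral> D\<close>, and the three conditions say that \<open>Z\<close> stays in \<open>{0..l}\<close>, that \<open>L\<^sub>0\<close> grows only
when \<open>Z = 0\<close>, and that \<open>L\<^sub>l\<close> grows only when \<open>Z = l\<close> (\<open>reflection_solution_iff_feedback_solution\<close>). This
is two-sided Skorokhod reflection of a path whose drift depends on the accumulated net push.

The decisive property is monotonicity. For two solutions, \<open>D - D'\<close> can increase only while \<open>Z \<le> Z'\<close>
and decrease only while \<open>Z \<ge> Z'\<close>, so the difference of the net pushes is bounded by the difference of
the remaining terms, and Gronwall's inequality closes the argument. The lemma
\<open>approx_reflection_stable\<close> proves this on a grid and with a tolerance, which has two uses.
Clipped Euler schemes on dyadic grids form a Cauchy sequence, uniformly on bounded time intervals
(\<open>push_uniformly_Cauchy\<close>); their limit \<open>D\<close> is continuous. Any solution, sampled on the grids, stays close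
to the schemes, so its net push is the same limit (\<open>feedback_solution_net_push\<close>). Each
scheme is moreover a measurable function of finitely many values of the path, so the limits are random
variables.

It remains to split \<open>D\<close> into the two pushes. As \<open>l > 0\<close>, every time has a neighbourhood in which \<open>Z\<close> avoids
\<open>0\<close> or avoids \<open>l\<close>. In such a neighbourhood one of the two pushes is constant and the other one is \<open>D\<close> up to
a constant. Patching these neighbourhoods together (\<open>interval_induct_avoiding\<close>) yields the convergence
of the two pushes separately and their uniqueness.\<close>

section \<open>Flatness as local constancy\<close>

text \<open>The Stieltjes measure of \<open>L\<close> gives \<open>{a<..c}\<close> the mass \<open>L c - L a\<close>, so flatness forbids any growth on
an interval that misses \<open>S\<close>. For the converse, the times outside the closed set \<open>S\<close> are covered by
the countably many intervals with rational end points on which \<open>L\<close> does not grow. The form with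
intervals is the only one used afterwards: it passes to limits and is visible on a grid.\<close>

lemma flat_off_iff_locally_constant:
  fixes L :: "real \<Rightarrow> real"
  assumes cont: "continuous_on {0..} L" and mono: "mono_on {0..} L" and S: "closed S"
  shows "flat_off L S \<longleftrightarrow> (\<forall>a c. 0 \<le> a \<and> a \<le> c \<and> {a..c} \<inter> S = {} \<longrightarrow> L a = L c)"
proof -
  \<comment> \<open>The constant extension to negative times makes the integrator continuous at \<open>0\<close>: no atom there.\<close>
  define F where "F = (\<lambda>s. L (max 0 s))"
  define \<mu> where "\<mu> = interval_measure F"
  have F_mono: "F a \<le> F b" if "a \<le> b" for a b
    unfolding F_def using that by (intro mono_onD[OF mono]) auto
  have "continuous_on UNIV F"
    unfolding F_def by (intro continuous_on_compose2[OF cont] continuous_intros) auto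
  then have F_cont: "continuous (at_right a) F" for a
    by (auto simp: continuous_on_eq_continuous_at intro: continuous_at_imp_continuous_at_within)
  have Ioc: "emeasure \<mu> {a<..b} = ennreal (F b - F a)" if "a \<le> b" for a b
    unfolding \<mu>_def using emeasure_interval_measure_Ioc[OF that F_mono F_cont] .
  have flat: "flat_off L S \<longleftrightarrow> (\<integral>\<^sup>+ s. indicator (- S) s * indicator {0..} s \<partial>\<mu>) = 0"
    unfolding flat_off_def \<mu>_def F_def ..
  show ?thesis
  proof
    assume *: "flat_off L S"
    show "\<forall>a c. 0 \<le> a \<and> a \<le> c \<and> {a..c} \<inter> S = {} \<longrightarrow> L a = L c"
    proof (intro allI impI)
      fix a c :: real assume ac: "0 \<le> a \<and> a \<le> c \<and> {a..c} \<inter> S = {}"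
      have "emeasure \<mu> {a<..c} = (\<integral>\<^sup>+ s. indicator {a<..c} s \<partial>\<mu>)"
        by (subst nn_integral_indicator) (auto simp: \<mu>_def)
      also have "\<dots> \<le> (\<integral>\<^sup>+ s. indicator (- S) s * indicator {0..} s \<partial>\<mu>)"
        using ac by (intro nn_integral_mono) (auto simp: indicator_def disjoint_iff)
      also have "\<dots> = 0" using * flat by simp
      finally have "F c - F a \<le> 0" using Ioc[of a c] ac by (simp add: ennreal_eq_0_iff)
      then show "L a = L c" using F_mono[of a c] ac by (simp add: F_def max_def)
    qed
  next
    assume *: "\<forall>a c. 0 \<le> a \<and> a \<le> c \<and> {a..c} \<inter> S = {} \<longrightarrow> L a = L c"
    define P where "P = {(p, q). p \<in> \<rat> \<and> q \<in> \<rat> \<and> p \<le> q \<and> F p = F q}"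
    define U where "U = (\<Union>(p, q)\<in>P. {p<..q})"
    have "P \<subseteq> \<rat> \<times> \<rat>" by (auto simp: P_def)
    then have "countable P"
      by (rule countable_subset) (simp add: countable_rat)
    have "U \<in> null_sets \<mu>"
      unfolding U_def
    proof (rule null_sets_UN'[OF \<open>countable P\<close>])
      fix i assume "i \<in> P"
      then show "(case i of (p, q) \<Rightarrow> {p<..q}) \<in> null_sets \<mu>"
        by (auto simp: P_def Ioc null_sets_def) (auto simp: \<mu>_def)
    qed
    have sub: "t \<in> U" if t: "t \<notin> S" "t \<ge> 0" for t
    proof -
      have "open (- S)" using S by (rule open_Compl)
      then obtain d where d: "d > 0" "\<And>s. dist s t < d \<Longrightarrow> s \<notin> S"
        using t by (metis ComplD ComplI open_dist)
      obtain p where p: "p \<in> \<rat>" "t - d < p" "p < t" using Rats_dense_in_real[of "t - d" t] d by auto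
      obtain q where q: "q \<in> \<rat>" "t < q" "q < t + d" using Rats_dense_in_real[of t "t + d"] d by auto
      have "{max 0 p..max 0 q} \<inter> S = {}"
        using d(2) p q t by (force simp: dist_real_def)
      then have "F p = F q" unfolding F_def using *[rule_format, of "max 0 p" "max 0 q"] p q by auto
      then have "(p, q) \<in> P" using p q by (auto simp: P_def)
      then show ?thesis unfolding U_def using p q by (intro UN_I[of "(p, q)"]) auto
    qed
    have "(\<integral>\<^sup>+ s. indicator (- S) s * indicator {0..} s \<partial>\<mu>) \<le> (\<integral>\<^sup>+ s. indicator U s \<partial>\<mu>)"
      using sub by (intro nn_integral_mono) (auto simp: indicator_def)
    also have "\<dots> = 0" using \<open>U \<in> null_sets \<mu>\<close> by (simp add: null_sets_def)
    finally show "flat_off L S" using flat by simp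
  qed
qed

section \<open>Reflection of a path with memory\<close>

text \<open>This is \<open>X - Y\<^sub>0\<close> when \<open>w t = x + b t - v t\<close> and \<open>f\<close>, \<open>g\<close> are the pushes at the two barriers.
Subtracting the moving lower barrier turns the moving strip into the fixed interval \<open>{0..l}\<close>, at the
price of the memory term \<open>K * \<integral> (f - g)\<close>.\<close>

definition reflected_path :: "real \<Rightarrow> (real \<Rightarrow> real) \<Rightarrow> (real \<Rightarrow> real) \<Rightarrow> (real \<Rightarrow> real) \<Rightarrow> real \<Rightarrow> real" where
  "reflected_path K w f g t = w t + (f t - g t) + K * integral {0..t} (\<lambda>s. f s - g s)"

definition feedback_solution ::
  "real \<Rightarrow> real \<Rightarrow> (real \<Rightarrow> real) \<Rightarrow> (real \<Rightarrow> real) \<Rightarrow> (real \<Rightarrow> real) \<Rightarrow> bool" where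
  "feedback_solution l K w f g \<longleftrightarrow>
     continuous_on {0..} f \<and> mono_on {0..} f \<and> f 0 = 0 \<and>
     continuous_on {0..} g \<and> mono_on {0..} g \<and> g 0 = 0 \<and>
     (\<forall>t\<ge>0. reflected_path K w f g t \<in> {0..l}) \<and>
     (\<forall>a c. 0 \<le> a \<and> a \<le> c \<and> (\<forall>t\<in>{a..c}. reflected_path K w f g t \<noteq> 0) \<longrightarrow> f a = f c) \<and>
     (\<forall>a c. 0 \<le> a \<and> a \<le> c \<and> (\<forall>t\<in>{a..c}. reflected_path K w f g t \<noteq> l) \<longrightarrow> g a = g c)"

lemma feedback_solutionD:
  assumes "feedback_solution l K w f g"
  shows "continuous_on {0..} f" "mono_on {0..} f" "f 0 = 0"
    "continuous_on {0..} g" "mono_on {0..} g" "g 0 = 0"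
    "t \<ge> 0 \<Longrightarrow> reflected_path K w f g t \<in> {0..l}"
    "0 \<le> a \<Longrightarrow> a \<le> c \<Longrightarrow> \<forall>t\<in>{a..c}. reflected_path K w f g t \<noteq> 0 \<Longrightarrow> f a = f c"
    "0 \<le> a \<Longrightarrow> a \<le> c \<Longrightarrow> \<forall>t\<in>{a..c}. reflected_path K w f g t \<noteq> l \<Longrightarrow> g a = g c"
  using assms unfolding feedback_solution_def by blast+

lemma continuous_on_integral_from_0:
  fixes f :: "real \<Rightarrow> real"
  assumes "continuous_on {0..} f"
  shows "continuous_on {0..} (\<lambda>t. integral {0..t} f)"
  unfolding continuous_on_eq_continuous_within
proof
  fix t :: real assume t: "t \<in> {0..}"
  have "continuous_on {0..t + 1} (\<lambda>t. integral {0..t} f)"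
    by (intro indefinite_integral_continuous_1 integrable_continuous_real
        continuous_on_subset[OF assms]) auto
  then have "continuous (at t within {0..t + 1}) (\<lambda>t. integral {0..t} f)"
    using t by (auto simp: continuous_on_eq_continuous_within)
  moreover have "at t within {0..t + 1} = at t within {0..}"
    by (rule at_within_nhd[of _ "{..<t + 1}"]) auto
  ultimately show "continuous (at t within {0..}) (\<lambda>t. integral {0..t} f)" by simp
qed

lemma reflected_path_continuous:
  assumes "continuous_on {0..} w" "continuous_on {0..} f" "continuous_on {0..} g"
  shows "continuous_on {0..} (reflected_path K w f g)"
proof -
  have "continuous_on {0..} (\<lambda>s. f s - g s)" by (intro continuous_intros assms)
  from continuous_on_integral_from_0[OF this] show ?thesis
    unfolding reflected_path_def[abs_def] by (intro continuous_intros assms)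
qed

text \<open>Since \<open>Y\<^sub>0 t = v t - K * \<integral> (f - g)\<close>, the distance of \<open>X\<close> from the lower barrier is the reflected path, and
contact with the two barriers means that it equals \<open>0\<close> or \<open>l\<close>.\<close>

lemma reflection_solution_iff_feedback_solution:
  assumes b: "continuous_on {0..} b"
  shows "reflection_solution l K x v b f g \<longleftrightarrow> feedback_solution l K (\<lambda>t. x + b t - v * t) f g"
proof (cases "continuous_on {0..} f \<and> mono_on {0..} f \<and> f 0 = 0 \<and>
    continuous_on {0..} g \<and> mono_on {0..} g \<and> g 0 = 0")
  case False
  then show ?thesis unfolding reflection_solution_def feedback_solution_def Let_def by blast
next
  case True
  define R where "R = reflected_path K (\<lambda>t. x + b t - v * t) f g"
  define Y where "Y = (\<lambda>t. integral {0..t} (\<lambda>s. v - K * (f s - g s)))"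
  have Y: "integral {0..t} (\<lambda>s. v - K * (f s - g s)) = Y t" for t by (simp add: Y_def)
  have R_cont: "continuous_on {0..} R"
    unfolding R_def using True by (intro reflected_path_continuous continuous_intros b) auto
  have X: "x + b t + f t - g t = Y t + R t" if "t \<ge> 0" for t
  proof -
    have int: "(\<lambda>s. f s - g s) integrable_on {0..t}"
      using True by (intro integrable_continuous_real continuous_intros) (auto intro: continuous_on_subset)
    have "Y t = integral {0..t} (\<lambda>s. v) - integral {0..t} (\<lambda>s. K * (f s - g s))"
      unfolding Y_def by (intro integral_diff integrable_on_mult_right int) auto
    also have "\<dots> = v * t - K * integral {0..t} (\<lambda>s. f s - g s)"
      using that by simp
    finally show ?thesis by (simp add: R_def reflected_path_def)
  qed
  have flat: "flat_off h {t. 0 \<le> t \<and> R t = y} \<longleftrightarrow>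
      (\<forall>a c. 0 \<le> a \<and> a \<le> c \<and> (\<forall>t\<in>{a..c}. R t \<noteq> y) \<longrightarrow> h a = h c)"
    if "continuous_on {0..} h" "mono_on {0..} h" for h y
  proof -
    have "closed {t \<in> {0..}. R t = y}"
      by (rule continuous_closed_preimage_constant[OF R_cont]) simp
    then have "closed {t. 0 \<le> t \<and> R t = y}" by simp
    from flat_off_iff_locally_constant[OF that this] show ?thesis
      by (auto simp: disjoint_iff)
  qed
  have sets: "{t. 0 \<le> t \<and> Y t = x + b t + f t - g t} = {t. 0 \<le> t \<and> R t = 0}"
    "{t. 0 \<le> t \<and> Y t + l = x + b t + f t - g t} = {t. 0 \<le> t \<and> R t = l}"
    using X by auto
  have between: "(\<forall>t\<ge>0. Y t \<le> x + b t + f t - g t \<and> x + b t + f t - g t \<le> Y t + l) \<longleftrightarrow>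
      (\<forall>t\<ge>0. R t \<in> {0..l})"
    using X by auto
  show ?thesis
    unfolding reflection_solution_def feedback_solution_def Let_def Y R_def[symmetric]
      sets between using True flat[of f 0] flat[of g l] by simp
qed

section \<open>Stability of discrete reflection\<close>

text \<open>A discrete reflection on a grid of mesh \<open>h\<close>, with the equations and the contact
conditions relaxed by \<open>e\<close>: \<open>D\<close> is the net push,
\<open>I\<close> its accumulated integral, \<open>Z\<close> the reflected path. The tolerance is what lets one notion cover
three different objects: the clipped Euler scheme, the same scheme of a coarser grid read on a finer
one, and the samples of a continuous-time solution.\<close>

definition approx_reflection ::
  "real \<Rightarrow> real \<Rightarrow> real \<Rightarrow> real \<Rightarrow> nat \<Rightarrow> (nat \<Rightarrow> real) \<Rightarrow>
   (nat \<Rightarrow> real) \<Rightarrow> (nat \<Rightarrow> real) \<Rightarrow> (nat \<Rightarrow> real) \<Rightarrow> bool" where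
  "approx_reflection l K h e N w D I Z \<longleftrightarrow>
     D 0 = 0 \<and> I 0 = 0 \<and>
     (\<forall>k\<le>N. Z k \<in> {0..l} \<and> \<bar>Z k - (w k + D k + K * I k)\<bar> \<le> e) \<and>
     (\<forall>k<N. \<bar>I (Suc k) - I k - h * D k\<bar> \<le> e * h \<and>
       (D k < D (Suc k) \<longrightarrow> Z (Suc k) \<le> e) \<and>
       (D (Suc k) < D k \<longrightarrow> l - e \<le> Z (Suc k)))"

text \<open>The reason for uniqueness and convergence at once. If \<open>D - D'\<close> increases in a step, then \<open>D\<close> has
increased or \<open>D'\<close> has decreased, so that \<open>Z\<close> is near the bottom or \<open>Z'\<close> near the top of \<open>{0..l}\<close>; in
both cases \<open>Z - Z' \<le> e\<close>, and therefore \<open>D - D' \<le> 3 e - K (I - I')\<close>. Hence the difference of the net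
pushes can never exceed what the difference of the memory terms allows, and a discrete Gronwall
argument bounds the latter.\<close>

lemma approx_reflection_stable:
  assumes A: "approx_reflection l K h e N w D I Z"
    and A': "approx_reflection l K h e N w D' I' Z'"
    and pos: "K > 0" "h \<ge> 0" "e \<ge> 0" and k: "k \<le> N"
  shows "\<bar>D k - D' k\<bar> \<le> 5 * e * exp (K * (real k * h))"
proof -
  \<comment> \<open>The Gronwall bound for the memory term: the constant \<open>5\<close> pays for the \<open>3 e\<close> of the net push and for
    the error \<open>2 e h\<close> of the two recursions.\<close>
  define a where "a = (\<lambda>k. 5 * e / K * ((1 + K * h) ^ k - 1))"
  have Ka: "K * a k = 5 * e * (1 + K * h) ^ k - 5 * e" for k
    using pos by (simp add: a_def field_simps)
  have a_Suc: "a (Suc k) = a k + 5 * e * h * (1 + K * h) ^ k" for k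
    using pos by (simp add: a_def field_simps)
  have a_mono: "a k \<le> a (Suc k)" for k
    using pos by (simp add: a_Suc)
  have Ka_mono: "K * a k \<le> K * a (Suc k)" for k
    using a_mono pos by simp
  have "\<bar>I k - I' k\<bar> \<le> a k \<and> \<bar>D k - D' k\<bar> \<le> 3 * e + K * a k"
    using k
  proof (induction k)
    case 0
    then show ?case using A A' pos by (simp add: approx_reflection_def a_def)
  next
    case (Suc k)
    then have IH: "\<bar>I k - I' k\<bar> \<le> a k" "\<bar>D k - D' k\<bar> \<le> 3 * e + K * a k" and kN: "k < N" by auto
    have "\<bar>h * (D k - D' k)\<bar> \<le> h * (3 * e + K * a k)"
      using IH pos by (simp add: abs_mult mult_left_mono)
    also have "\<dots> = 5 * e * h * (1 + K * h) ^ k - 2 * (e * h)"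
      unfolding Ka by (simp add: algebra_simps)
    finally have hE: "\<bar>h * D k - h * D' k\<bar> \<le> 5 * e * h * (1 + K * h) ^ k - 2 * (e * h)"
      by (simp add: algebra_simps)
    have "\<bar>I (Suc k) - I k - h * D k\<bar> \<le> e * h" "\<bar>I' (Suc k) - I' k - h * D' k\<bar> \<le> e * h"
      using A A' kN by (auto simp: approx_reflection_def)
    with hE IH(1) have I: "\<bar>I (Suc k) - I' (Suc k)\<bar> \<le> a (Suc k)"
      unfolding a_Suc by linarith
    then have KI: "\<bar>K * I (Suc k) - K * I' (Suc k)\<bar> \<le> K * a (Suc k)"
      using pos by (simp add: abs_mult flip: right_diff_distrib)
    have Z: "\<bar>Z (Suc k) - (w (Suc k) + D (Suc k) + K * I (Suc k))\<bar> \<le> e"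
      "\<bar>Z' (Suc k) - (w (Suc k) + D' (Suc k) + K * I' (Suc k))\<bar> \<le> e"
      "0 \<le> Z (Suc k)" "Z (Suc k) \<le> l" "0 \<le> Z' (Suc k)" "Z' (Suc k) \<le> l"
      using A A' Suc.prems by (auto simp: approx_reflection_def)
    have J: "D k < D (Suc k) \<longrightarrow> Z (Suc k) \<le> e" "D (Suc k) < D k \<longrightarrow> l - e \<le> Z (Suc k)"
      "D' k < D' (Suc k) \<longrightarrow> Z' (Suc k) \<le> e" "D' (Suc k) < D' k \<longrightarrow> l - e \<le> Z' (Suc k)"
      using A A' kN by (auto simp: approx_reflection_def)
    have "D (Suc k) - D' (Suc k) \<le> 3 * e + K * a (Suc k)"
    proof (cases "D (Suc k) - D' (Suc k) \<le> D k - D' k")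
      case True then show ?thesis using IH(2) Ka_mono[of k] by linarith
    next
      case False
      then have "Z (Suc k) - Z' (Suc k) \<le> e" using J Z(3-6) by linarith
      then show ?thesis using Z(1,2) KI by linarith
    qed
    moreover have "D' (Suc k) - D (Suc k) \<le> 3 * e + K * a (Suc k)"
    proof (cases "D' (Suc k) - D (Suc k) \<le> D' k - D k")
      case True then show ?thesis using IH(2) Ka_mono[of k] by linarith
    next
      case False
      then have "Z' (Suc k) - Z (Suc k) \<le> e" using J Z(3-6) by linarith
      then show ?thesis using Z(1,2) KI by linarith
    qed
    ultimately show ?case using I by linarith
  qed
  then have "\<bar>D k - D' k\<bar> \<le> 5 * e * (1 + K * h) ^ k"
    using pos unfolding Ka by linarith
  also have "(1 + K * h) ^ k \<le> exp (K * h) ^ k"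
    using pos by (intro power_mono exp_ge_add_one_self) auto
  also have "exp (K * h) ^ k = exp (K * (real k * h))"
    by (simp add: exp_of_nat_mult[symmetric] mult_ac)
  finally show ?thesis using pos by (simp add: mult_left_mono)
qed

lemma approx_reflection_weaken:
  assumes "approx_reflection l K h e N w D I Z" "e \<le> e'" "h \<ge> 0"
  shows "approx_reflection l K h e' N w D I Z"
  using assms mult_right_mono[OF assms(2,3)] unfolding approx_reflection_def by fastforce

section \<open>Paths on dyadic grids\<close>

lemma dyadic_modulus:
  fixes f :: "real \<Rightarrow> real"
  assumes "continuous_on {0..} f" "e > 0"
  shows "\<forall>\<^sub>F n in sequentially. \<forall>s\<in>{0..T}. \<forall>t\<in>{0..T}. \<bar>s - t\<bar> \<le> 1 / 2 ^ n \<longrightarrow> \<bar>f s - f t\<bar> \<le> e"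
proof -
  have "uniformly_continuous_on {0..T} f"
    using assms by (intro compact_uniformly_continuous continuous_on_subset[OF assms(1)]) auto
  then obtain d where d: "d > 0" "\<And>s t. s \<in> {0..T} \<Longrightarrow> t \<in> {0..T} \<Longrightarrow> dist t s < d \<Longrightarrow> dist (f t) (f s) < e"
    using assms(2) unfolding uniformly_continuous_on_def by metis
  have "(\<lambda>n. (1 / 2) ^ n :: real) \<longlonglongrightarrow> 0" by (rule LIMSEQ_power_zero) simp
  then have "\<forall>\<^sub>F n in sequentially. (1 / 2) ^ n < d" using d(1) by (rule order_tendstoD)
  then show ?thesis
  proof eventually_elim
    case (elim n)
    show ?case
    proof (intro ballI impI)
      fix s t assume "s \<in> {0..T}" "t \<in> {0..T}" "\<bar>s - t\<bar> \<le> 1 / 2 ^ n"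
      with elim d(2)[of t s] show "\<bar>f s - f t\<bar> \<le> e"
        by (simp add: dist_real_def power_one_over)
    qed
  qed
qed

text \<open>The local error of the left-point rule. On a cell of a grid it gives the relaxed recursion for the
accumulated integral of a sampled solution.\<close>

lemma integral_increment_near:
  fixes f :: "real \<Rightarrow> real"
  assumes f: "continuous_on {0..} f" and ac: "0 \<le> a" "a \<le> c"
    and y: "\<And>s. s \<in> {a..c} \<Longrightarrow> \<bar>f s - y\<bar> \<le> e"
  shows "\<bar>integral {0..c} f - integral {0..a} f - (c - a) * y\<bar> \<le> e * (c - a)"
proof -
  have int: "f integrable_on {p..q}" if "p \<ge> 0" for p q
    by (intro integrable_continuous_real continuous_on_subset[OF f]) (use that in auto)
  have "((\<lambda>s. f s - y) has_integral (integral {a..c} f - (c - a) * y)) {a..c}"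
    using has_integral_diff[OF integrable_integral[OF int[OF ac(1), of c]] has_integral_const_real[of y a c]] ac
    by simp
  moreover have "0 \<le> e" using y[of a] ac by force
  ultimately have "\<bar>integral {a..c} f - (c - a) * y\<bar> \<le> e * (c - a)"
    using has_integral_bound[of e "\<lambda>s. f s - y" _ a c] y ac by simp
  moreover have "integral {0..a} f + integral {a..c} f = integral {0..c} f"
    by (rule Henstock_Kurzweil_Integration.integral_combine[OF ac int]) simp
  ultimately show ?thesis by (simp add: algebra_simps)
qed

lemma avoids_nearby:
  fixes Z :: "real \<Rightarrow> real"
  assumes "continuous_on {0..} Z" "x \<ge> 0" "Z x \<noteq> y"
  obtains d where "d > 0"
    "\<And>s. s \<ge> 0 \<Longrightarrow> \<bar>s - x\<bar> < d \<Longrightarrow> Z s \<noteq> y"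
proof -
  have "\<bar>Z x - y\<bar> > 0" using assms by simp
  then obtain d where d: "d > 0" "\<And>s. s \<ge> 0 \<Longrightarrow> \<bar>s - x\<bar> < d \<Longrightarrow> \<bar>Z s - Z x\<bar> < \<bar>Z x - y\<bar>"
    using assms unfolding continuous_on_iff dist_real_def by (metis atLeast_iff)
  have "Z s \<noteq> y" if "s \<ge> 0" "\<bar>s - x\<bar> < d" for s
    using d(2)[OF that] by (auto simp: abs_minus_commute)
  then show thesis using that[of d] d(1) by blast
qed

text \<open>A continuous \<open>Z\<close> cannot be at \<open>y\<close> and at \<open>y'\<close> at the same time, so near every point it avoids one of
them, and by compactness finitely many intervals of these two kinds cover \<open>{a..c}\<close>. Used with the two
barriers, this reduces a statement about both pushes to intervals on which only one of them acts.\<close>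

lemma interval_induct_avoiding:
  fixes Z :: "real \<Rightarrow> real"
  assumes Z: "continuous_on {0..} Z" and "y \<noteq> y'" and ac: "0 \<le> a" "a \<le> c"
    and y: "\<And>a c. 0 \<le> a \<Longrightarrow> a \<le> c \<Longrightarrow> (\<forall>s\<in>{a..c}. Z s \<noteq> y) \<Longrightarrow> P a c"
    and y': "\<And>a c. 0 \<le> a \<Longrightarrow> a \<le> c \<Longrightarrow> (\<forall>s\<in>{a..c}. Z s \<noteq> y') \<Longrightarrow> P a c"
    and trans: "\<And>a b c. P a b \<Longrightarrow> P b c \<Longrightarrow> P a c"
  shows "P a c"
proof -
  have "0 \<le> a \<longrightarrow> P a c"
    using \<open>a \<le> c\<close>
  proof (induction rule: Bolzano)
    case (trans a b c)
    then show ?case using assms(7) by auto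
  next
    case (local x)
    have "x \<ge> 0" using local ac by simp
    have "Z x \<noteq> y \<or> Z x \<noteq> y'" using \<open>y \<noteq> y'\<close> by auto
    then show ?case
    proof
      assume "Z x \<noteq> y"
      then obtain d where d: "d > 0"
        "\<And>s. s \<ge> 0 \<Longrightarrow> \<bar>s - x\<bar> < d \<Longrightarrow> Z s \<noteq> y"
        using avoids_nearby[OF Z \<open>x \<ge> 0\<close>] by blast
      show ?thesis
      proof (intro exI[of _ d] conjI allI impI d(1))
        fix a c assume "a \<le> x \<and> x \<le> c \<and> c - a < d" "0 \<le> a"
        then show "P a c" by (intro y ballI d(2)) auto
      qed
    next
      assume "Z x \<noteq> y'"
      then obtain d where d: "d > 0"
        "\<And>s. s \<ge> 0 \<Longrightarrow> \<bar>s - x\<bar> < d \<Longrightarrow> Z s \<noteq> y'"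
        using avoids_nearby[OF Z \<open>x \<ge> 0\<close>] by blast
      show ?thesis
      proof (intro exI[of _ d] conjI allI impI d(1))
        fix a c assume "a \<le> x \<and> x \<le> c \<and> c - a < d" "0 \<le> a"
        then show "P a c" by (intro y' ballI d(2)) auto
      qed
    qed
  qed
  then show ?thesis using ac by simp
qed

definition cell :: "nat \<Rightarrow> real \<Rightarrow> nat" where
  "cell n t = nat \<lfloor>t * 2 ^ n\<rfloor>"

lemma cell_bounds:
  assumes "t \<ge> 0"
  shows "real (cell n t) / 2 ^ n \<le> t" "t < real (Suc (cell n t)) / 2 ^ n"
proof -
  have "real (cell n t) = of_int \<lfloor>t * 2 ^ n\<rfloor>" using assms by (simp add: cell_def)
  then have "real (cell n t) \<le> t * 2 ^ n" "t * 2 ^ n < real (cell n t) + 1" by linarith+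
  then show "real (cell n t) / 2 ^ n \<le> t" "t < real (Suc (cell n t)) / 2 ^ n"
    by (simp_all add: field_simps)
qed

lemma cell_eqI:
  assumes "real k / 2 ^ n \<le> t" "t < real (Suc k) / 2 ^ n"
  shows "cell n t = k"
proof -
  have "\<lfloor>t * 2 ^ n\<rfloor> = int k" using assms by (intro floor_unique) (simp_all add: field_simps)
  then show ?thesis by (simp add: cell_def)
qed

lemma cell_grid [simp]: "cell n (real k / 2 ^ n) = k"
  by (intro cell_eqI) (simp_all add: divide_strict_right_mono)

lemma cell_mono: "s \<le> t \<Longrightarrow> cell n s \<le> cell n t"
  by (simp add: cell_def nat_mono floor_mono)

lemma cell_coarsen:
  assumes "n \<le> m"
  shows "cell m t div 2 ^ (m - n) = cell n t"
proof -
  have "t * 2 ^ n = (t * 2 ^ m) / real_of_int (2 ^ (m - n))"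
    using power_add[of "2::real" "m - n" n] assms by simp
  then have "\<lfloor>t * 2 ^ n\<rfloor> = \<lfloor>t * 2 ^ m\<rfloor> div 2 ^ (m - n)"
    using floor_divide_real_eq_div[of "2 ^ (m - n)" "t * 2 ^ m"] by simp
  then show ?thesis by (simp add: cell_def nat_div_distrib' nat_power_eq)
qed

section \<open>The clipped Euler scheme\<close>

text \<open>On the grid of mesh \<open>1 / 2 ^ n\<close> the memory term is advanced with the current net push, and the
tentative new position \<open>z\<close> is clipped to \<open>{0..l}\<close>. The components are the push at \<open>0\<close>, the push at
\<open>l\<close>, and the integral of their difference.\<close>

primrec euler :: "real \<Rightarrow> real \<Rightarrow> (real \<Rightarrow> real) \<Rightarrow> nat \<Rightarrow> nat \<Rightarrow> real \<times> real \<times> real" where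
  "euler l K w n 0 = (0, 0, 0)"
| "euler l K w n (Suc k) =
     (let (p, q, i) = euler l K w n k;
          j = i + (p - q) / 2 ^ n;
          z = w (real (Suc k) / 2 ^ n) + (p - q) + K * j
      in (p + max 0 (- z), q + max 0 (z - l), j))"

definition euler_lower where "euler_lower l K w n k = fst (euler l K w n k)"
definition euler_upper where "euler_upper l K w n k = fst (snd (euler l K w n k))"
definition euler_integral where "euler_integral l K w n k = snd (snd (euler l K w n k))"
definition euler_push where "euler_push l K w n k = euler_lower l K w n k - euler_upper l K w n k"
definition euler_state where
  "euler_state l K w n k = w (real k / 2 ^ n) + euler_push l K w n k + K * euler_integral l K w n k"

lemma euler_0 [simp]:
  "euler_lower l K w n 0 = 0" "euler_upper l K w n 0 = 0" "euler_push l K w n 0 = 0"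
  "euler_integral l K w n 0 = 0" "euler_state l K w n 0 = w 0"
  by (simp_all add: euler_lower_def euler_upper_def euler_push_def euler_integral_def euler_state_def)

lemma euler_integral_Suc:
  "euler_integral l K w n (Suc k) = euler_integral l K w n k + euler_push l K w n k / 2 ^ n"
  by (simp add: euler_lower_def euler_upper_def euler_push_def euler_integral_def Let_def split_beta)

lemma euler_Suc:
  fixes l K w n k
  defines "z \<equiv> w (real (Suc k) / 2 ^ n) + euler_push l K w n k + K * euler_integral l K w n (Suc k)"
  shows "euler_lower l K w n (Suc k) = euler_lower l K w n k + max 0 (- z)"
    "euler_upper l K w n (Suc k) = euler_upper l K w n k + max 0 (z - l)"
    "euler_state l K w n (Suc k) = z + max 0 (- z) - max 0 (z - l)"
proof -
  show 1: "euler_lower l K w n (Suc k) = euler_lower l K w n k + max 0 (- z)"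
    "euler_upper l K w n (Suc k) = euler_upper l K w n k + max 0 (z - l)"
    by (simp_all add: z_def euler_lower_def euler_upper_def euler_push_def euler_integral_def
        Let_def split_beta)
  show "euler_state l K w n (Suc k) = z + max 0 (- z) - max 0 (z - l)"
    by (simp only: euler_state_def euler_push_def 1) (simp add: z_def euler_push_def)
qed

text \<open>Every value of the scheme depends on the values of the driving path at finitely many times. This
is how the limiting processes inherit measurability.\<close>

lemma euler_measurable:
  assumes "\<And>t. t \<ge> 0 \<Longrightarrow> W t \<in> borel_measurable M"
  shows "(\<lambda>\<omega>. euler_lower l K (\<lambda>t. W t \<omega>) n k) \<in> borel_measurable M \<and>
    (\<lambda>\<omega>. euler_upper l K (\<lambda>t. W t \<omega>) n k) \<in> borel_measurable M \<and>
    (\<lambda>\<omega>. euler_integral l K (\<lambda>t. W t \<omega>) n k) \<in> borel_measurable M"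
proof (induction k)
  case (Suc k)
  then have [measurable]:
    "(\<lambda>\<omega>. euler_lower l K (\<lambda>t. W t \<omega>) n k) \<in> borel_measurable M"
    "(\<lambda>\<omega>. euler_upper l K (\<lambda>t. W t \<omega>) n k) \<in> borel_measurable M"
    "(\<lambda>\<omega>. euler_integral l K (\<lambda>t. W t \<omega>) n k) \<in> borel_measurable M"
    by auto
  have [measurable]: "W (real (Suc k) / 2 ^ n) \<in> borel_measurable M"
    by (rule assms) simp
  show ?case
    unfolding euler_Suc euler_integral_Suc euler_push_def by (intro conjI) measurable
qed simp

text \<open>Defined through \<open>lim\<close>, hence meaningful as total functions of the path: measurability in a random
parameter then holds whether or not the scheme converges.\<close>

definition skorokhod_lower where
  "skorokhod_lower l K w t = lim (\<lambda>n. euler_lower l K w n (cell n t))"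
definition skorokhod_upper where
  "skorokhod_upper l K w t = lim (\<lambda>n. euler_upper l K w n (cell n t))"

locale feedback_driver =
  fixes l K :: real and w :: "real \<Rightarrow> real"
  assumes l_pos: "0 < l" and K_pos: "0 < K"
    and w_cont: "continuous_on {0..} w" and w_start: "w 0 \<in> {0..l}"
begin

abbreviation "lower \<equiv> euler_lower l K w"
abbreviation "upper \<equiv> euler_upper l K w"
abbreviation "push \<equiv> euler_push l K w"
abbreviation "area \<equiv> euler_integral l K w"
abbreviation "state \<equiv> euler_state l K w"

lemma state_bounds: "state n k \<in> {0..l}"
proof (cases k)
  case 0
  then show ?thesis using w_start by simp
next
  case (Suc j)
  then show ?thesis using l_pos by (auto simp: euler_Suc(3) max_def)
qed

lemma lower_step: "lower n k \<le> lower n (Suc k)" "lower n k \<noteq> lower n (Suc k) \<Longrightarrow> state n (Suc k) = 0"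
  using l_pos by (auto simp: euler_Suc max_def split: if_splits)

lemma upper_step: "upper n k \<le> upper n (Suc k)" "upper n k \<noteq> upper n (Suc k) \<Longrightarrow> state n (Suc k) = l"
  using l_pos by (auto simp: euler_Suc max_def split: if_splits)

lemma lower_mono: "i \<le> j \<Longrightarrow> lower n i \<le> lower n j"
  by (rule lift_Suc_mono_le[of "lower n", OF lower_step(1)])

lemma upper_mono: "i \<le> j \<Longrightarrow> upper n i \<le> upper n j"
  by (rule lift_Suc_mono_le[of "upper n", OF upper_step(1)])

lemma lower_constant:
  assumes "i \<le> j" "\<And>k. i < k \<Longrightarrow> k \<le> j \<Longrightarrow> state n k \<noteq> 0"
  shows "lower n i = lower n j"
  using assms
proof (induction rule: dec_induct)
  case (step k)
  then show ?case using lower_step(2)[of n k] by force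
qed simp

lemma upper_constant:
  assumes "i \<le> j" "\<And>k. i < k \<Longrightarrow> k \<le> j \<Longrightarrow> state n k \<noteq> l"
  shows "upper n i = upper n j"
  using assms
proof (induction rule: dec_induct)
  case (step k)
  then show ?case using upper_step(2)[of n k] by force
qed simp

text \<open>The starting point of a step lies in \<open>{0..l}\<close>, so clipping cannot remove more than the length of the
step. With the net push bounded, the jumps of the scheme therefore vanish with the mesh, which makes
the limit continuous.\<close>

lemma push_step:
  "\<bar>push n (Suc k) - push n k\<bar> \<le>
     \<bar>w (real (Suc k) / 2 ^ n) - w (real k / 2 ^ n)\<bar> + K * \<bar>push n k\<bar> / 2 ^ n"
proof -
  define z where "z = w (real (Suc k) / 2 ^ n) + push n k + K * area n (Suc k)"
  have "push n (Suc k) - push n k = max 0 (- z) - max 0 (z - l)"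
    by (simp add: euler_push_def euler_Suc z_def)
  then have "\<bar>push n (Suc k) - push n k\<bar> \<le> \<bar>z - state n k\<bar>"
    using state_bounds[of n k] by (auto simp: max_def)
  also have "z - state n k = w (real (Suc k) / 2 ^ n) - w (real k / 2 ^ n) + K * push n k / 2 ^ n"
    by (simp add: z_def euler_integral_Suc euler_state_def algebra_simps)
  also have "\<bar>\<dots>\<bar> \<le> \<bar>w (real (Suc k) / 2 ^ n) - w (real k / 2 ^ n)\<bar> + \<bar>K * push n k / 2 ^ n\<bar>"
    by (rule abs_triangle_ineq)
  finally show ?thesis using K_pos by (simp add: abs_mult)
qed

lemma euler_approx_reflection:
  "approx_reflection l K (1 / 2 ^ n) 0 N (\<lambda>k. w (real k / 2 ^ n)) (push n) (area n) (state n)"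
proof -
  have "state n (Suc k) \<le> 0" if "push n k < push n (Suc k)" for k
    using that lower_step[of n k] upper_step[of n k] by (force simp: euler_push_def)
  moreover have "l \<le> state n (Suc k)" if "push n (Suc k) < push n k" for k
    using that lower_step[of n k] upper_step[of n k] by (force simp: euler_push_def)
  ultimately show ?thesis
    unfolding approx_reflection_def using state_bounds
    by (auto simp: euler_integral_Suc euler_state_def)
qed

text \<open>Comparison with the constant path \<open>w 0\<close> without pushing: it is a discrete reflection whose tolerance
bounds \<open>\<bar>w t - w 0\<bar>\<close> on \<open>{0..T}\<close>, whatever the mesh.\<close>

lemma push_bound:
  assumes "T \<ge> 0"
  obtains C where "C \<ge> 0" "\<And>n k. real k / 2 ^ n \<le> T \<Longrightarrow> \<bar>push n k\<bar> \<le> C"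
proof -
  have "compact (w ` {0..T})"
    by (intro compact_continuous_image continuous_on_subset[OF w_cont]) auto
  then obtain b where b: "\<And>t. t \<in> {0..T} \<Longrightarrow> \<bar>w t\<bar> \<le> b"
    using compact_imp_bounded bounded_real by (metis imageI)
  have "b \<ge> 0" using b[of 0] assms by simp
  show thesis
  proof
    show "0 \<le> 5 * (2 * b) * exp (K * T)" using \<open>b \<ge> 0\<close> by simp
    fix n k assume kT: "real k / 2 ^ n \<le> T"
    have wb: "\<bar>w 0 - w (real j / 2 ^ n)\<bar> \<le> 2 * b" if "j \<le> k" for j
    proof -
      have "real j / 2 ^ n \<le> T" using that kT by (intro order_trans[OF _ kT] divide_right_mono) auto
      then show ?thesis using b[of 0] b[of "real j / 2 ^ n"] assms by auto
    qed
    have zero: "approx_reflection l K (1 / 2 ^ n) (2 * b) k (\<lambda>k. w (real k / 2 ^ n))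
        (\<lambda>_. 0) (\<lambda>_. 0) (\<lambda>_. w 0)"
      using wb w_start \<open>b \<ge> 0\<close> by (auto simp: approx_reflection_def)
    have "approx_reflection l K (1 / 2 ^ n) (2 * b) k (\<lambda>k. w (real k / 2 ^ n))
        (push n) (area n) (state n)"
      by (rule approx_reflection_weaken[OF euler_approx_reflection]) (use \<open>b \<ge> 0\<close> in auto)
    from approx_reflection_stable[OF this zero K_pos, of k]
    have "\<bar>push n k\<bar> \<le> 5 * (2 * b) * exp (K * (real k / 2 ^ n))"
      using \<open>b \<ge> 0\<close> by simp
    also have "\<dots> \<le> 5 * (2 * b) * exp (K * T)"
      using mult_left_mono[OF kT, of K] K_pos \<open>b \<ge> 0\<close> by (intro mult_left_mono) auto
    finally show "\<bar>push n k\<bar> \<le> 5 * (2 * b) * exp (K * T)" .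
  qed
qed

text \<open>This makes two grids comparable. The coarse scheme moves only when a coarse cell begins; the memory
term is interpolated linearly inside the cell so that it satisfies the fine recursion exactly, and
the remaining error is the oscillation of \<open>w\<close> over a coarse cell plus one coarse increment of the
memory term.\<close>

lemma coarse_euler_approx_reflection:
  fixes n m :: nat
  defines "q \<equiv> 2 ^ (m - n)"
  assumes nm: "n \<le> m" and N: "real N / 2 ^ m \<le> T"
    and osc: "\<forall>s\<in>{0..T}. \<forall>t\<in>{0..T}. \<bar>s - t\<bar> \<le> 1 / 2 ^ n \<longrightarrow> \<bar>w s - w t\<bar> \<le> e"
    and C: "\<And>k. real k / 2 ^ n \<le> T \<Longrightarrow> \<bar>push n k\<bar> \<le> C" "C \<ge> 0" "K * C / 2 ^ n \<le> e"
  shows "approx_reflection l K (1 / 2 ^ m) (2 * e) N (\<lambda>j. w (real j / 2 ^ m))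
     (\<lambda>j. push n (j div q))
     (\<lambda>j. area n (j div q) + real (j mod q) * push n (j div q) / 2 ^ m)
     (\<lambda>j. state n (j div q))"
proof -
  have q: "q > 0" "(2::real) ^ m = real q * 2 ^ n" using power_add[of "2::real" "m - n" n] nm by (simp_all add: q_def)
  have "0 \<le> K * C / 2 ^ n" using K_pos C(2) by simp
  then have e: "e \<ge> 0" using C(3) by linarith
  have E: "\<bar>state n (j div q) - (w (real j / 2 ^ m) + push n (j div q) +
      K * (area n (j div q) + real (j mod q) * push n (j div q) / 2 ^ m))\<bar> \<le> 2 * e"
    if "j \<le> N" for j
  proof -
    define k r where "k = j div q" and "r = j mod q"
    have j: "real j = real k * real q + real r"
      unfolding k_def r_def by (metis div_mult_mod_eq of_nat_add of_nat_mult)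
    have r: "real r \<le> real q" using q by (simp add: r_def less_imp_le)
    have jm: "real j / 2 ^ m = real k / 2 ^ n + real r / 2 ^ m"
      unfolding q(2) j using q(1) by (simp add: field_simps)
    have rm: "real r / 2 ^ m \<le> 1 / 2 ^ n" unfolding q(2) using r q(1) by (simp add: field_simps)
    have jT: "real j / 2 ^ m \<le> T"
      using that by (intro order_trans[OF _ N] divide_right_mono) auto
    have kT: "real k / 2 ^ n \<le> real j / 2 ^ m" unfolding jm by simp
    have 1: "\<bar>w (real k / 2 ^ n) - w (real j / 2 ^ m)\<bar> \<le> e"
    proof (rule osc[rule_format])
      show "\<bar>real k / 2 ^ n - real j / 2 ^ m\<bar> \<le> 1 / 2 ^ n" using jm rm by simp
      show "real k / 2 ^ n \<in> {0..T}" "real j / 2 ^ m \<in> {0..T}" using jT kT by auto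
    qed
    have "real r * \<bar>push n k\<bar> / 2 ^ m \<le> C / 2 ^ n"
      using mult_mono[OF rm C(1)[of k]] jT kT by simp
    then have "K * (real r * \<bar>push n k\<bar> / 2 ^ m) \<le> K * (C / 2 ^ n)"
      using K_pos by (intro mult_left_mono) auto
    then have 2: "\<bar>K * (real r * push n k / 2 ^ m)\<bar> \<le> e"
      using C(3) K_pos by (simp add: abs_mult)
    have eq: "state n k - (w (real j / 2 ^ m) + push n k + K * (area n k + real r * push n k / 2 ^ m))
      = (w (real k / 2 ^ n) - w (real j / 2 ^ m)) - K * (real r * push n k / 2 ^ m)"
      by (simp add: euler_state_def algebra_simps)
    show ?thesis unfolding k_def[symmetric] r_def[symmetric] eq
      using abs_triangle_ineq4 add_mono[OF 1 2] by (metis mult_2 order_trans)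
  qed
  have "area n (Suc j div q) + real (Suc j mod q) * push n (Suc j div q) / 2 ^ m
     - (area n (j div q) + real (j mod q) * push n (j div q) / 2 ^ m)
     = 1 / 2 ^ m * push n (j div q)" for j
  proof (cases "Suc (j mod q) = q")
    case True
    then have "real q = real (j mod q) + 1" by linarith
    then have "real q * push n (j div q) / 2 ^ m = (real (j mod q) + 1) * push n (j div q) / 2 ^ m"
      by (simp only:)
    moreover have "push n (j div q) / 2 ^ n = real q * push n (j div q) / 2 ^ m"
      using q by simp
    ultimately show ?thesis
      using True by (simp add: div_Suc mod_Suc euler_integral_Suc add_divide_distrib distrib_right)
  next
    case False
    then show ?thesis by (simp add: div_Suc mod_Suc field_simps)
  qed
  moreover have "push n (j div q) < push n (Suc j div q) \<Longrightarrow> state n (Suc j div q) \<le> 2 * e"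
    "push n (Suc j div q) < push n (j div q) \<Longrightarrow> l - 2 * e \<le> state n (Suc j div q)" for j
    using euler_approx_reflection[of n "Suc (j div q)"] e
    by (auto simp: approx_reflection_def div_Suc split: if_splits)
  ultimately show ?thesis
    using E state_bounds e by (auto simp: approx_reflection_def)
qed

lemma push_uniformly_Cauchy:
  assumes "T \<ge> 0"
  shows "uniformly_Cauchy_on {0..T} (\<lambda>n t. push n (cell n t))"
proof (rule uniformly_Cauchy_onI')
  fix \<epsilon> :: real assume "\<epsilon> > 0"
  obtain C where C: "C \<ge> 0" "\<And>n k. real k / 2 ^ n \<le> T \<Longrightarrow> \<bar>push n k\<bar> \<le> C"
    using push_bound[OF assms] by blast
  \<comment> \<open>The tolerance is \<open>2 e\<close>, and stability costs the factor \<open>5 exp (K T)\<close>; this leaves \<open>\<epsilon> / 2\<close>.\<close>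
  define e where "e = \<epsilon> / (20 * exp (K * T))"
  have "e > 0" using \<open>\<epsilon> > 0\<close> by (simp add: e_def)
  have "(\<lambda>n. K * C * (1 / 2) ^ n) \<longlonglongrightarrow> K * C * 0"
    by (intro tendsto_mult tendsto_const LIMSEQ_power_zero) simp
  then have "\<forall>\<^sub>F n in sequentially. K * C * (1 / 2) ^ n < e"
    using \<open>e > 0\<close> by (intro order_tendstoD(2)[where y = "K * C * 0"]) auto
  with dyadic_modulus[OF w_cont \<open>e > 0\<close>, of T]
  have "\<forall>\<^sub>F n in sequentially. (\<forall>s\<in>{0..T}. \<forall>t\<in>{0..T}. \<bar>s - t\<bar> \<le> 1 / 2 ^ n \<longrightarrow> \<bar>w s - w t\<bar> \<le> e)
      \<and> K * C / 2 ^ n \<le> e"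
    by eventually_elim (auto simp: power_one_over)
  then obtain M where M: "\<And>n. n \<ge> M \<Longrightarrow> (\<forall>s\<in>{0..T}. \<forall>t\<in>{0..T}. \<bar>s - t\<bar> \<le> 1 / 2 ^ n \<longrightarrow> \<bar>w s - w t\<bar> \<le> e)
      \<and> K * C / 2 ^ n \<le> e"
    by (auto simp: eventually_sequentially)
  have "dist (push n (cell n t)) (push m (cell m t)) < \<epsilon>"
    if t: "t \<in> {0..T}" and nm: "n \<ge> M" "m > n" for t n m
  proof -
    have kT: "real (cell m t) / 2 ^ m \<le> T" using cell_bounds(1)[of t m] t by auto
    have coarse: "approx_reflection l K (1 / 2 ^ m) (2 * e) (cell m t) (\<lambda>j. w (real j / 2 ^ m))
     (\<lambda>j. push n (j div 2 ^ (m - n)))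
     (\<lambda>j. area n (j div 2 ^ (m - n)) + real (j mod 2 ^ (m - n)) * push n (j div 2 ^ (m - n)) / 2 ^ m)
     (\<lambda>j. state n (j div 2 ^ (m - n)))"
      using nm M kT C by (intro coarse_euler_approx_reflection[where T = T and C = C]) auto
    have fine: "approx_reflection l K (1 / 2 ^ m) (2 * e) (cell m t) (\<lambda>k. w (real k / 2 ^ m))
        (push m) (area m) (state m)"
      by (rule approx_reflection_weaken[OF euler_approx_reflection]) (use \<open>e > 0\<close> in auto)
    have "\<bar>push n (cell m t div 2 ^ (m - n)) - push m (cell m t)\<bar>
        \<le> 5 * (2 * e) * exp (K * (real (cell m t) * (1 / 2 ^ m)))"
      using approx_reflection_stable[OF coarse fine K_pos, of "cell m t"] \<open>e > 0\<close> by simp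
    also have "\<dots> \<le> 5 * (2 * e) * exp (K * T)"
      using mult_left_mono[OF kT, of K] K_pos \<open>e > 0\<close> by (intro mult_left_mono) auto
    also have "\<dots> < \<epsilon>" using \<open>\<epsilon> > 0\<close> by (simp add: e_def)
    finally show ?thesis using nm by (simp add: cell_coarsen dist_real_def)
  qed
  then show "\<exists>M. \<forall>t\<in>{0..T}. \<forall>m\<ge>M. \<forall>n>m. dist (push m (cell m t)) (push n (cell n t)) < \<epsilon>"
    by blast
qed

section \<open>The limit of the scheme is a solution\<close>

definition D :: "real \<Rightarrow> real" where
  "D t = lim (\<lambda>n. push n (cell n t))"

lemma push_tendsto_uniformly:
  assumes "e > 0"
  shows "\<forall>\<^sub>F n in sequentially. \<forall>t\<in>{0..T}. \<bar>push n (cell n t) - D t\<bar> \<le> e"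
proof (cases "T \<ge> 0")
  case True
  then have "uniform_limit {0..T} (\<lambda>n t. push n (cell n t)) D sequentially"
    using Cauchy_uniformly_convergent[OF push_uniformly_Cauchy]
    unfolding uniformly_convergent_uniform_limit_iff D_def[abs_def] by blast
  from uniform_limitD[OF this assms] show ?thesis
    by eventually_elim (auto simp: dist_real_def less_imp_le)
qed simp

text \<open>Nearby times lie in the same or in adjacent cells, and the jump between adjacent cells is small.\<close>

lemma D_continuous: "continuous_on {0..} D"
  unfolding continuous_on_iff
proof (intro ballI allI impI)
  fix t \<epsilon> :: real assume t: "t \<in> {0..}" and "\<epsilon> > 0"
  define e where "e = \<epsilon> / 5"
  have e: "e > 0" using \<open>\<epsilon> > 0\<close> by (simp add: e_def)
  obtain C where C: "C \<ge> 0" "\<And>n k. real k / 2 ^ n \<le> t + 1 \<Longrightarrow> \<bar>push n k\<bar> \<le> C"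
    using push_bound[of "t + 1"] t by auto
  have "(\<lambda>n. K * C * (1 / 2) ^ n) \<longlonglongrightarrow> K * C * 0"
    by (intro tendsto_mult tendsto_const LIMSEQ_power_zero) simp
  then have "\<forall>\<^sub>F n in sequentially. K * C * (1 / 2) ^ n < e"
    using e by (intro order_tendstoD(2)[where y = "K * C * 0"]) auto
  with dyadic_modulus[OF w_cont e, of "t + 1"] push_tendsto_uniformly[OF e, of "t + 1"]
  have "\<forall>\<^sub>F n in sequentially. K * C / 2 ^ n < e \<and>
      (\<forall>s\<in>{0..t + 1}. \<forall>r\<in>{0..t + 1}. \<bar>s - r\<bar> \<le> 1 / 2 ^ n \<longrightarrow> \<bar>w s - w r\<bar> \<le> e) \<and>
      (\<forall>s\<in>{0..t + 1}. \<bar>push n (cell n s) - D s\<bar> \<le> e)"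
    by eventually_elim (auto simp: power_one_over)
  then obtain n where n: "K * C / 2 ^ n < e"
      "\<And>s r. s \<in> {0..t + 1} \<Longrightarrow> r \<in> {0..t + 1} \<Longrightarrow> \<bar>s - r\<bar> \<le> 1 / 2 ^ n \<Longrightarrow> \<bar>w s - w r\<bar> \<le> e"
      "\<And>s. s \<in> {0..t + 1} \<Longrightarrow> \<bar>push n (cell n s) - D s\<bar> \<le> e"
    by (auto simp: eventually_sequentially)
  have jump: "\<bar>push n (Suc k) - push n k\<bar> \<le> 2 * e" if "real (Suc k) / 2 ^ n \<le> t + 1" for k
  proof -
    have k: "real k / 2 ^ n \<le> t + 1" using that by (simp add: field_simps)
    have "real (Suc k) / 2 ^ n - real k / 2 ^ n = 1 / 2 ^ n" by (simp add: field_simps)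
    then have "\<bar>w (real (Suc k) / 2 ^ n) - w (real k / 2 ^ n)\<bar> \<le> e"
      using that k by (intro n(2)) auto
    moreover have "K * \<bar>push n k\<bar> / 2 ^ n \<le> K * C / 2 ^ n"
      using C(2)[OF k] K_pos by (intro divide_right_mono mult_left_mono) auto
    ultimately show ?thesis using push_step[of n k] n(1) by linarith
  qed
  have close: "\<bar>push n (cell n r) - push n (cell n s)\<bar> \<le> 2 * e"
    if "0 \<le> s" "s \<le> r" "r - s < 1 / 2 ^ n" "r \<le> t + 1" for s r
  proof -
    have "real (cell n r) / 2 ^ n < real (Suc (Suc (cell n s))) / 2 ^ n"
      using cell_bounds(1)[of r n] cell_bounds(2)[of s n] that by (simp add: field_simps)
    then have "cell n r \<le> Suc (cell n s)" by (simp add: field_simps)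
    then have "cell n r = cell n s \<or> cell n r = Suc (cell n s)"
      using cell_mono[OF that(2), of n] by linarith
    moreover have "real (cell n r) / 2 ^ n \<le> t + 1" using cell_bounds(1)[of r n] that by linarith
    ultimately show ?thesis using jump[of "cell n s"] e by auto
  qed
  show "\<exists>d>0. \<forall>s\<in>{0..}. dist s t < d \<longrightarrow> dist (D s) (D t) < \<epsilon>"
  proof (intro exI[of _ "1 / 2 ^ n"] conjI ballI impI)
    fix s :: real assume s: "s \<in> {0..}" "dist s t < 1 / 2 ^ n"
    moreover have "(1::real) / 2 ^ n \<le> 1" by simp
    ultimately have "s \<le> t + 1" unfolding dist_real_def by linarith
    then have "\<bar>push n (cell n s) - push n (cell n t)\<bar> \<le> 2 * e"
      using close[of s t] close[of t s] s t by (cases "s \<le> t") (auto simp: dist_real_def)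
    moreover have "\<bar>push n (cell n s) - D s\<bar> \<le> e" "\<bar>push n (cell n t) - D t\<bar> \<le> e"
      using n(3) s(1) t \<open>s \<le> t + 1\<close> by auto
    ultimately have "\<bar>D s - D t\<bar> \<le> 4 * e" by linarith
    then show "dist (D s) (D t) < \<epsilon>" using \<open>\<epsilon> > 0\<close> by (simp add: dist_real_def e_def)
  qed simp
qed

text \<open>The integral of the limit follows the recursion of the scheme up to the local error of the left-point
rule and the distance between \<open>D\<close> and the scheme. Both are at most a small \<open>d\<close> times the length of the
cell, so that they add up to at most \<open>2 d T\<close>.\<close>

lemma area_tendsto_uniformly:
  assumes "e > 0"
  shows "\<forall>\<^sub>F n in sequentially. \<forall>t\<in>{0..T}. \<bar>area n (cell n t) - integral {0..t} D\<bar> \<le> e"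
proof (cases "T \<ge> 0")
  case True
  define G where "G = (\<lambda>t. integral {0..t} D)"
  have G: "continuous_on {0..} G" unfolding G_def by (rule continuous_on_integral_from_0[OF D_continuous])
  define d where "d = e / (4 * (T + 1))"
  have d: "d > 0" "2 * d * T \<le> e / 2" using assms True by (simp_all add: d_def field_simps)
  have e2: "e / 2 > 0" using assms by simp
  from push_tendsto_uniformly[OF d(1), of T] dyadic_modulus[OF D_continuous d(1), of T]
    dyadic_modulus[OF G e2, of T]
  show ?thesis
  proof eventually_elim
    case (elim n)
    have grid: "\<bar>area n k - G (real k / 2 ^ n)\<bar> \<le> 2 * d * (real k / 2 ^ n)"
      if "real k / 2 ^ n \<le> T" for k
      using that
    proof (induction k)
      case 0
      then show ?case by (simp add: G_def)
    next
      case (Suc k)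
      define a c where "a = real k / 2 ^ n" and "c = real (Suc k) / 2 ^ n"
      have ca: "c - a = 1 / 2 ^ n" by (simp add: a_def c_def field_simps)
      then have ac: "0 \<le> a" "a \<le> c" "c \<le> T" using Suc.prems by (auto simp: a_def c_def intro: order_trans[of _ "a + 1 / 2 ^ n"])
      have "\<bar>D s - push n k\<bar> \<le> 2 * d" if "s \<in> {a..c}" for s
      proof -
        have "\<bar>s - a\<bar> \<le> 1 / 2 ^ n" "s \<in> {0..T}" "a \<in> {0..T}" using that ca ac by auto
        then have "\<bar>D s - D a\<bar> \<le> d" "\<bar>push n (cell n a) - D a\<bar> \<le> d" using elim by blast+
        then show ?thesis by (simp add: a_def)
      qed
      then have "\<bar>G c - G a - (c - a) * push n k\<bar> \<le> 2 * d * (c - a)"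
        unfolding G_def by (rule integral_increment_near[OF D_continuous ac(1,2)])
      moreover have "\<bar>area n k - G a\<bar> \<le> 2 * d * a" using Suc.IH ac by (simp add: a_def)
      moreover have "area n (Suc k) = area n k + (c - a) * push n k" by (simp add: euler_integral_Suc ca)
      ultimately have "\<bar>area n (Suc k) - G c\<bar> \<le> 2 * d * a + 2 * d * (c - a)" by linarith
      then show ?case by (simp add: algebra_simps c_def)
    qed
    show ?case
    proof
      fix t assume t: "t \<in> {0..T}"
      define r where "r = real (cell n t) / 2 ^ n"
      have r: "0 \<le> r" "r \<le> t" "t - r \<le> 1 / 2 ^ n"
        using cell_bounds[of t n] t by (auto simp: r_def add_divide_distrib)
      have "2 * d * r \<le> 2 * d * T" using r t d(1) by (intro mult_left_mono) auto
      then have "\<bar>area n (cell n t) - G r\<bar> \<le> e / 2"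
        using grid[of "cell n t"] r t d(2) unfolding r_def by auto
      moreover have "\<bar>G r - G t\<bar> \<le> e / 2" using elim(3) r t by auto
      ultimately show "\<bar>area n (cell n t) - integral {0..t} D\<bar> \<le> e" unfolding G_def by linarith
    qed
  qed
qed simp

definition Z :: "real \<Rightarrow> real" where
  "Z t = w t + D t + K * integral {0..t} D"

lemma Z_continuous: "continuous_on {0..} Z"
  unfolding Z_def
  by (intro continuous_intros w_cont D_continuous continuous_on_integral_from_0)

lemma state_tendsto_uniformly:
  assumes "e > 0"
  shows "\<forall>\<^sub>F n in sequentially. \<forall>t\<in>{0..T}. \<bar>state n (cell n t) - Z t\<bar> \<le> e"
proof -
  define d where "d = e / (2 + K)"
  have d: "d > 0" using assms K_pos by (simp add: d_def)
  from push_tendsto_uniformly[OF d, of T] area_tendsto_uniformly[OF d, of T] dyadic_modulus[OF w_cont d, of T]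
  show ?thesis
  proof eventually_elim
    case (elim n)
    show ?case
    proof
      fix t assume t: "t \<in> {0..T}"
      define r where "r = real (cell n t) / 2 ^ n"
      have r: "0 \<le> r" "r \<le> t" "t - r \<le> 1 / 2 ^ n"
        using cell_bounds[of t n] t by (auto simp: r_def add_divide_distrib)
      have 1: "\<bar>w r - w t\<bar> \<le> d" "\<bar>push n (cell n t) - D t\<bar> \<le> d" using elim r t by auto
      have "\<bar>K * (area n (cell n t) - integral {0..t} D)\<bar> \<le> K * d"
        using elim(2) t K_pos by (simp add: abs_mult mult_left_mono)
      moreover have "state n (cell n t) - Z t = (w r - w t) + (push n (cell n t) - D t)
          + K * (area n (cell n t) - integral {0..t} D)"
        by (simp add: euler_state_def Z_def r_def algebra_simps)
      ultimately have "\<bar>state n (cell n t) - Z t\<bar> \<le> d + d + K * d" using 1 by linarith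
      also have "\<dots> = (2 + K) * d" by (simp add: algebra_simps)
      also have "\<dots> = e" using K_pos by (simp add: d_def)
      finally show "\<bar>state n (cell n t) - Z t\<bar> \<le> e" .
    qed
  qed
qed

lemma Z_bounds:
  assumes "t \<ge> 0"
  shows "Z t \<in> {0..l}"
proof -
  have "Z t \<ge> - e \<and> Z t \<le> l + e" if e: "e > 0" for e
  proof -
    obtain n where n: "\<bar>state n (cell n t) - Z t\<bar> \<le> e"
      using eventually_happens'[OF sequentially_bot state_tendsto_uniformly[OF e, of t]] assms by force
    moreover have "0 \<le> state n (cell n t)" "state n (cell n t) \<le> l"
      using state_bounds[of n "cell n t"] by auto
    ultimately show ?thesis by linarith
  qed
  then have "0 \<le> Z t + e" "Z t \<le> l + e" if "e > 0" for e
    using that by force+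
  then have "0 \<le> Z t" "Z t \<le> l" using field_le_epsilon by blast+
  then show ?thesis by simp
qed

text \<open>By compactness the limit keeps a positive distance from \<open>y\<close> on \<open>{a..c}\<close>, and the scheme converges
uniformly. The cell containing \<open>a\<close> is left out because its grid point may lie to the left of \<open>a\<close>.\<close>

lemma state_eventually_avoids:
  assumes ac: "0 \<le> a" "a \<le> c" and avoid: "\<forall>s\<in>{a..c}. Z s \<noteq> y"
  shows "\<forall>\<^sub>F n in sequentially. \<forall>k. cell n a < k \<longrightarrow> k \<le> cell n c \<longrightarrow> state n k \<noteq> y"
proof -
  have "continuous_on {a..c} (\<lambda>s. \<bar>Z s - y\<bar>)"
    using ac by (intro continuous_intros continuous_on_subset[OF Z_continuous]) auto
  then obtain p where p: "p \<in> {a..c}" "\<And>s. s \<in> {a..c} \<Longrightarrow> \<bar>Z p - y\<bar> \<le> \<bar>Z s - y\<bar>"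
    using continuous_attains_inf[of "{a..c}" "\<lambda>s. \<bar>Z s - y\<bar>"] ac by auto
  define e where "e = \<bar>Z p - y\<bar> / 2"
  have e: "e > 0" using avoid p(1) by (simp add: e_def)
  from state_tendsto_uniformly[OF e, of c] show ?thesis
  proof eventually_elim
    case (elim n)
    show ?case
    proof (intro allI impI)
      fix k assume k: "cell n a < k" "k \<le> cell n c"
      have "a < real (Suc (cell n a)) / 2 ^ n" using cell_bounds(2)[OF ac(1)] .
      also have "\<dots> \<le> real k / 2 ^ n" using k by (intro divide_right_mono) auto
      finally have 1: "a \<le> real k / 2 ^ n" by simp
      have "real k / 2 ^ n \<le> real (cell n c) / 2 ^ n" using k by (intro divide_right_mono) auto
      also have "\<dots> \<le> c" using cell_bounds(1)[of c n] ac by simp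
      finally have 2: "real k / 2 ^ n \<le> c" .
      have "\<bar>state n k - Z (real k / 2 ^ n)\<bar> \<le> e"
        using elim[rule_format, of "real k / 2 ^ n"] 2 by simp
      moreover have "2 * e \<le> \<bar>Z (real k / 2 ^ n) - y\<bar>" using p(2) 1 2 by (simp add: e_def)
      ultimately show "state n k \<noteq> y" using e by linarith
    qed
  qed
qed

lemma lower_eventually_constant:
  assumes "0 \<le> a" "a \<le> c" "\<forall>s\<in>{a..c}. Z s \<noteq> 0"
  shows "\<forall>\<^sub>F n in sequentially. lower n (cell n a) = lower n (cell n c)"
  using state_eventually_avoids[OF assms]
  by eventually_elim (auto intro!: lower_constant cell_mono assms)

lemma upper_eventually_constant:
  assumes "0 \<le> a" "a \<le> c" "\<forall>s\<in>{a..c}. Z s \<noteq> l"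
  shows "\<forall>\<^sub>F n in sequentially. upper n (cell n a) = upper n (cell n c)"
  using state_eventually_avoids[OF assms]
  by eventually_elim (auto intro!: upper_constant cell_mono assms)

lemma push_tendsto:
  assumes "t \<ge> 0"
  shows "(\<lambda>n. push n (cell n t)) \<longlonglongrightarrow> D t"
proof (rule tendstoI)
  fix e :: real assume "e > 0"
  then have "e / 2 > 0" by simp
  from push_tendsto_uniformly[OF this, of t]
  show "\<forall>\<^sub>F n in sequentially. dist (push n (cell n t)) (D t) < e"
    by eventually_elim (use \<open>e > 0\<close> assms in \<open>force simp: dist_real_def\<close>)
qed

abbreviation "L0 \<equiv> skorokhod_lower l K w"
abbreviation "Ll \<equiv> skorokhod_upper l K w"

text \<open>Convergence of the net push alone does not separate the two pushes. It does so on an interval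
where the limiting path avoids one of the barriers: there one of the two pushes is eventually
constant, and the other one is determined by the net push.\<close>

lemma lower_tendsto:
  assumes "t \<ge> 0"
  shows "(\<lambda>n. lower n (cell n t)) \<longlonglongrightarrow> L0 t"
proof -
  have "convergent (\<lambda>n. lower n (cell n t) - lower n (cell n 0))"
  proof (rule interval_induct_avoiding[OF Z_continuous, of 0 l 0 t])
    fix a c :: real assume ac: "0 \<le> a" "a \<le> c" and "\<forall>s\<in>{a..c}. Z s \<noteq> 0"
    from lower_eventually_constant[OF this]
    have "\<forall>\<^sub>F n in sequentially. lower n (cell n c) - lower n (cell n a) = 0"
      by eventually_elim simp
    then show "convergent (\<lambda>n. lower n (cell n c) - lower n (cell n a))"
      by (intro convergentI tendsto_eventually)
  next
    fix a c :: real assume ac: "0 \<le> a" "a \<le> c" and "\<forall>s\<in>{a..c}. Z s \<noteq> l"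
    from upper_eventually_constant[OF this]
    have "\<forall>\<^sub>F n in sequentially. push n (cell n c) - push n (cell n a)
        = lower n (cell n c) - lower n (cell n a)"
      by eventually_elim (simp add: euler_push_def)
    moreover have "(\<lambda>n. push n (cell n c) - push n (cell n a)) \<longlonglongrightarrow> D c - D a"
      using ac by (intro tendsto_diff push_tendsto) auto
    ultimately have "(\<lambda>n. lower n (cell n c) - lower n (cell n a)) \<longlonglongrightarrow> D c - D a"
      by (rule Lim_transform_eventually[rotated])
    then show "convergent (\<lambda>n. lower n (cell n c) - lower n (cell n a))"
      by (rule convergentI)
  next
    fix a b c
    assume "convergent (\<lambda>n. lower n (cell n b) - lower n (cell n a))"
      "convergent (\<lambda>n. lower n (cell n c) - lower n (cell n b))"
    from convergent_add[OF this] show "convergent (\<lambda>n. lower n (cell n c) - lower n (cell n a))"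
      by simp
  qed (use l_pos assms in auto)
  then have "convergent (\<lambda>n. lower n (cell n t))"
    using assms by (simp add: cell_def)
  then show ?thesis unfolding skorokhod_lower_def by (simp add: convergent_LIMSEQ_iff)
qed

lemma upper_tendsto:
  assumes "t \<ge> 0"
  shows "(\<lambda>n. upper n (cell n t)) \<longlonglongrightarrow> Ll t" and "Ll t = L0 t - D t"
proof -
  have "(\<lambda>n. lower n (cell n t) - push n (cell n t)) \<longlonglongrightarrow> L0 t - D t"
    by (intro tendsto_diff lower_tendsto push_tendsto assms)
  then have *: "(\<lambda>n. upper n (cell n t)) \<longlonglongrightarrow> L0 t - D t"
    by (simp add: euler_push_def)
  then show "Ll t = L0 t - D t" unfolding skorokhod_upper_def by (rule limI)
  with * show "(\<lambda>n. upper n (cell n t)) \<longlonglongrightarrow> Ll t" by simp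
qed

lemma L0_flat:
  assumes "0 \<le> a" "a \<le> c" "\<forall>s\<in>{a..c}. Z s \<noteq> 0"
  shows "L0 a = L0 c"
  using LIMSEQ_unique[OF lower_tendsto[of c] Lim_transform_eventually[OF lower_tendsto[of a]
    lower_eventually_constant[OF assms]]] assms by simp

lemma Ll_flat:
  assumes "0 \<le> a" "a \<le> c" "\<forall>s\<in>{a..c}. Z s \<noteq> l"
  shows "Ll a = Ll c"
  using LIMSEQ_unique[OF upper_tendsto(1)[of c] Lim_transform_eventually[OF upper_tendsto(1)[of a]
    upper_eventually_constant[OF assms]]] assms by simp

text \<open>Near a time away from \<open>0\<close> the lower push is constant; near a time away from \<open>l\<close> the upper push is
constant, and the lower push differs from the continuous net push by that constant.\<close>

lemma L0_continuous: "continuous_on {0..} L0"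
  unfolding continuous_on_eq_continuous_within
proof
  fix t :: real assume t: "t \<in> {0..}"
  then have t0: "t \<ge> 0" by simp
  have "Z t \<noteq> 0 \<or> Z t \<noteq> l" using l_pos by auto
  then show "continuous (at t within {0..}) L0"
  proof
    assume "Z t \<noteq> 0"
    then obtain d where d: "d > 0" "\<And>s. s \<ge> 0 \<Longrightarrow> \<bar>s - t\<bar> < d \<Longrightarrow> Z s \<noteq> 0"
      using avoids_nearby[OF Z_continuous t0] by blast
    have "L0 t = L0 s" if s: "s \<in> {0..}" "dist s t < d" for s
    proof (cases "s \<le> t")
      case True
      have "\<forall>r\<in>{s..t}. Z r \<noteq> 0" using d(2) s by (auto simp: dist_real_def)
      then show ?thesis using L0_flat[of s t] True s by simp
    next
      case False
      have "\<forall>r\<in>{t..s}. Z r \<noteq> 0" using d(2) s t0 by (auto simp: dist_real_def)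
      then show ?thesis using L0_flat[of t s] False t0 by simp
    qed
    then show ?thesis
      by (rule continuous_transform_within[OF continuous_const d(1) t])
  next
    assume "Z t \<noteq> l"
    then obtain d where d: "d > 0" "\<And>s. s \<ge> 0 \<Longrightarrow> \<bar>s - t\<bar> < d \<Longrightarrow> Z s \<noteq> l"
      using avoids_nearby[OF Z_continuous t0] by blast
    have "Ll t = Ll s" if s: "s \<in> {0..}" "dist s t < d" for s
    proof (cases "s \<le> t")
      case True
      have "\<forall>r\<in>{s..t}. Z r \<noteq> l" using d(2) s by (auto simp: dist_real_def)
      then show ?thesis using Ll_flat[of s t] True s by simp
    next
      case False
      have "\<forall>r\<in>{t..s}. Z r \<noteq> l" using d(2) s t0 by (auto simp: dist_real_def)
      then show ?thesis using Ll_flat[of t s] False t0 by simp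
    qed
    then have eq: "D s + Ll t = L0 s" if "s \<in> {0..}" "dist s t < d" for s
      using that upper_tendsto(2)[of s] by simp
    have "continuous (at t within {0..}) D"
      using D_continuous t by (simp add: continuous_on_eq_continuous_within)
    then have "continuous (at t within {0..}) (\<lambda>s. D s + Ll t)"
      by (intro continuous_add continuous_const)
    from continuous_transform_within[OF this d(1) t eq] show ?thesis .
  qed
qed

lemma reflected_path_limit: "t \<ge> 0 \<Longrightarrow> reflected_path K w L0 Ll t = Z t"
  unfolding reflected_path_def Z_def
  using integral_cong[of "{0..t}" "\<lambda>s. L0 s - Ll s" D] by (simp add: upper_tendsto(2))

lemma feedback_solution_exists: "feedback_solution l K w L0 Ll"
  unfolding feedback_solution_def
proof (intro conjI allI impI)
  show "continuous_on {0..} L0" by (rule L0_continuous)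
  have "continuous_on {0..} (\<lambda>t. L0 t - D t)" by (intro continuous_intros L0_continuous D_continuous)
  then show "continuous_on {0..} Ll"
    by (rule continuous_on_eq) (simp add: upper_tendsto(2))
  show "mono_on {0..} L0"
    by (rule mono_onI, rule LIMSEQ_le[OF lower_tendsto lower_tendsto])
       (auto intro!: lower_mono cell_mono)
  show "mono_on {0..} Ll"
    by (rule mono_onI, rule LIMSEQ_le[OF upper_tendsto(1) upper_tendsto(1)])
       (auto intro!: upper_mono cell_mono)
  show "L0 0 = 0" by (simp add: skorokhod_lower_def cell_def)
  show "Ll 0 = 0" by (simp add: skorokhod_upper_def cell_def)
  show "reflected_path K w L0 Ll t \<in> {0..l}" if "t \<ge> 0" for t
    using Z_bounds[OF that] reflected_path_limit[OF that] by simp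
  show "L0 a = L0 c" if "0 \<le> a \<and> a \<le> c \<and> (\<forall>t\<in>{a..c}. reflected_path K w L0 Ll t \<noteq> 0)" for a c
    using that by (intro L0_flat) (auto simp: reflected_path_limit)
  show "Ll a = Ll c" if "0 \<le> a \<and> a \<le> c \<and> (\<forall>t\<in>{a..c}. reflected_path K w L0 Ll t \<noteq> l)" for a c
    using that by (intro Ll_flat) (auto simp: reflected_path_limit)
qed

section \<open>Uniqueness\<close>

text \<open>If the net push increases over a cell, then \<open>f\<close> does, so the reflected path touches \<open>0\<close> somewhere in that
cell and is within its own modulus of continuity of \<open>0\<close> at the end of the cell; similarly at \<open>l\<close>.\<close>

lemma feedback_solution_sampled:
  fixes f g :: "real \<Rightarrow> real" and n N :: nat
  defines "E \<equiv> \<lambda>t. f t - g t" and "R \<equiv> reflected_path K w f g"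
  assumes sol: "feedback_solution l K w f g" and "e \<ge> 0" and N: "real N / 2 ^ n \<le> T"
    and modE: "\<forall>s\<in>{0..T}. \<forall>t\<in>{0..T}. \<bar>s - t\<bar> \<le> 1 / 2 ^ n \<longrightarrow> \<bar>E s - E t\<bar> \<le> e"
    and modR: "\<forall>s\<in>{0..T}. \<forall>t\<in>{0..T}. \<bar>s - t\<bar> \<le> 1 / 2 ^ n \<longrightarrow> \<bar>R s - R t\<bar> \<le> e"
  shows "approx_reflection l K (1 / 2 ^ n) e N (\<lambda>k. w (real k / 2 ^ n))
    (\<lambda>k. E (real k / 2 ^ n)) (\<lambda>k. integral {0..real k / 2 ^ n} E) (\<lambda>k. R (real k / 2 ^ n))"
  unfolding approx_reflection_def
proof (intro conjI allI impI)
  note sol = feedback_solutionD[OF sol]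
  have E_cont: "continuous_on {0..} E" unfolding E_def by (intro continuous_intros sol)
  show "E (real 0 / 2 ^ n) = 0" "integral {0..real 0 / 2 ^ n} E = 0" using sol by (simp_all add: E_def)
  show "R (real k / 2 ^ n) \<in> {0..l}" for k using sol(7) by (simp add: R_def)
  show "\<bar>R (real k / 2 ^ n) - (w (real k / 2 ^ n) + E (real k / 2 ^ n)
      + K * integral {0..real k / 2 ^ n} E)\<bar> \<le> e" for k
    using \<open>e \<ge> 0\<close> by (simp add: R_def reflected_path_def E_def)
  fix k assume "k < N"
  define a c where "a = real k / 2 ^ n" and "c = real (Suc k) / 2 ^ n"
  have ca: "c - a = 1 / 2 ^ n" by (simp add: a_def c_def field_simps)
  then have "a \<le> c" by (smt (verit) zero_le_divide_1_iff zero_le_power)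
  have "c \<le> real N / 2 ^ n" using \<open>k < N\<close> unfolding c_def by (intro divide_right_mono) auto
  then have ac: "0 \<le> a" "a \<le> c" "c \<le> T" using N \<open>a \<le> c\<close> by (auto simp: a_def)
  have near: "s \<in> {0..T}" "\<bar>s - a\<bar> \<le> 1 / 2 ^ n" "\<bar>c - s\<bar> \<le> 1 / 2 ^ n" if "s \<in> {a..c}" for s
    using that ac ca by auto
  have ac_T: "a \<in> {0..T}" "c \<in> {0..T}" using ac by auto
  have "\<bar>E s - E a\<bar> \<le> e" if "s \<in> {a..c}" for s
    using modE near[OF that] ac_T by blast
  from integral_increment_near[OF E_cont ac(1,2) this]
  show "\<bar>integral {0..real (Suc k) / 2 ^ n} E - integral {0..real k / 2 ^ n} E
      - 1 / 2 ^ n * E (real k / 2 ^ n)\<bar> \<le> e * (1 / 2 ^ n)"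
    unfolding ca a_def[symmetric] c_def[symmetric] .
  have f: "f a \<le> f c" and g: "g a \<le> g c" using sol(2,5) ac by (auto intro: mono_onD)
  show "R (real (Suc k) / 2 ^ n) \<le> e" if "E (real k / 2 ^ n) < E (real (Suc k) / 2 ^ n)"
  proof -
    have "f a \<noteq> f c" using that g unfolding E_def a_def[symmetric] c_def[symmetric] by auto
    then obtain s where s: "s \<in> {a..c}" "R s = 0" using sol(8)[OF ac(1,2)] R_def by blast
    then have "\<bar>R c - R s\<bar> \<le> e" using modR near[OF s(1)] ac_T by blast
    then show ?thesis using s by (simp add: c_def)
  qed
  show "l - e \<le> R (real (Suc k) / 2 ^ n)" if "E (real (Suc k) / 2 ^ n) < E (real k / 2 ^ n)"
  proof -
    have "g a \<noteq> g c" using that f unfolding E_def a_def[symmetric] c_def[symmetric] by auto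
    then obtain s where s: "s \<in> {a..c}" "R s = l" using sol(9)[OF ac(1,2)] R_def by blast
    then have "\<bar>R c - R s\<bar> \<le> e" using modR near[OF s(1)] ac_T by blast
    then show ?thesis using s by (simp add: c_def)
  qed
qed

text \<open>The samples of any solution and the Euler scheme are both discrete reflections of the same data with
vanishing tolerance. Stability identifies the net push of the solution as the limit of the scheme.\<close>

lemma feedback_solution_net_push:
  assumes sol: "feedback_solution l K w f g" and t: "t \<ge> 0"
  shows "f t - g t = D t"
proof -
  note S = feedback_solutionD[OF sol]
  define E R where "E = (\<lambda>t. f t - g t)" and "R = reflected_path K w f g"
  have E: "continuous_on {0..} E" unfolding E_def by (intro continuous_intros S)
  have R: "continuous_on {0..} R" unfolding R_def by (intro reflected_path_continuous w_cont S)
  have "(\<lambda>n. push n (cell n t)) \<longlonglongrightarrow> E t"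
  proof (rule tendstoI)
    fix \<epsilon> :: real assume "\<epsilon> > 0"
    define e where "e = \<epsilon> / (5 * exp (K * t) + 2)"
    have "5 * exp (K * t) + 2 > 0" by (simp add: add_pos_pos)
    then have e: "e > 0" "(5 * exp (K * t) + 2) * e = \<epsilon>" using \<open>\<epsilon> > 0\<close> by (simp_all add: e_def)
    from dyadic_modulus[OF E e(1), of t] dyadic_modulus[OF R e(1), of t]
    show "\<forall>\<^sub>F n in sequentially. dist (push n (cell n t)) (E t) < \<epsilon>"
    proof eventually_elim
      case (elim n)
      define r where "r = real (cell n t) / 2 ^ n"
      have r: "0 \<le> r" "r \<le> t" "\<bar>r - t\<bar> \<le> 1 / 2 ^ n"
        using cell_bounds[OF t, of n] by (auto simp: r_def add_divide_distrib)
      have sampled: "approx_reflection l K (1 / 2 ^ n) e (cell n t) (\<lambda>k. w (real k / 2 ^ n))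
        (\<lambda>k. E (real k / 2 ^ n)) (\<lambda>k. integral {0..real k / 2 ^ n} E) (\<lambda>k. R (real k / 2 ^ n))"
        unfolding E_def R_def
        by (rule feedback_solution_sampled[OF sol, where T = t])
           (use elim e(1) r(2) in \<open>simp_all add: E_def R_def r_def\<close>)
      have scheme: "approx_reflection l K (1 / 2 ^ n) e (cell n t) (\<lambda>k. w (real k / 2 ^ n))
        (push n) (area n) (state n)"
        by (rule approx_reflection_weaken[OF euler_approx_reflection]) (use e in auto)
      have "\<bar>push n (cell n t) - E r\<bar> \<le> 5 * e * exp (K * r)"
        using approx_reflection_stable[OF scheme sampled K_pos, of "cell n t"] e(1) by (simp add: r_def)
      also have "\<dots> \<le> 5 * e * exp (K * t)"
        using r(2) K_pos e(1) by (intro mult_left_mono) auto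
      finally have "\<bar>push n (cell n t) - E r\<bar> \<le> 5 * e * exp (K * t)" .
      moreover have "\<bar>E r - E t\<bar> \<le> e" using elim(1) r t by auto
      ultimately have "\<bar>push n (cell n t) - E t\<bar> \<le> 5 * e * exp (K * t) + e" by linarith
      also have "5 * e * exp (K * t) + e < (5 * exp (K * t) + 2) * e"
        using e(1) by (simp add: algebra_simps)
      finally show "dist (push n (cell n t)) (E t) < \<epsilon>" by (simp add: e(2) dist_real_def)
    qed
  qed
  from LIMSEQ_unique[OF this push_tendsto[OF t]] show ?thesis by (simp add: E_def)
qed

text \<open>The net push determines the reflected path, hence the times of contact. Where one barrier is
avoided, its push is constant, so the net push determines the increments of both pushes.\<close>

lemma feedback_solution_unique:
  assumes sol: "feedback_solution l K w f g" and t: "t \<ge> 0"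
  shows "f t = L0 t" "g t = Ll t"
proof -
  note S = feedback_solutionD[OF sol]
  note push = feedback_solution_net_push[OF sol]
  have R: "reflected_path K w f g s = Z s" if "s \<ge> 0" for s
    unfolding reflected_path_def Z_def
    using integral_cong[of "{0..s}" "\<lambda>s. f s - g s" D] that by (simp add: push)
  have "f t - f 0 = L0 t - L0 0"
  proof (rule interval_induct_avoiding[OF Z_continuous, of 0 l 0 t])
    fix a c assume "0 \<le> a" "a \<le> c" "\<forall>s\<in>{a..c}. Z s \<noteq> 0"
    then show "f c - f a = L0 c - L0 a" using S(8)[of a c] L0_flat[of a c] by (simp add: R)
  next
    fix a c assume "0 \<le> a" "a \<le> c" "\<forall>s\<in>{a..c}. Z s \<noteq> l"
    then have "g a = g c" "Ll a = Ll c" using S(9)[of a c] Ll_flat[of a c] by (simp_all add: R)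
    then show "f c - f a = L0 c - L0 a"
      using push[of a] push[of c] upper_tendsto(2)[of a] upper_tendsto(2)[of c] \<open>0 \<le> a\<close> \<open>a \<le> c\<close>
      by simp
  qed (use l_pos t in auto)
  then show "f t = L0 t" using S(3) feedback_solutionD(3)[OF feedback_solution_exists] by simp
  then show "g t = Ll t" using push[OF t] upper_tendsto(2)[OF t] by simp
qed

end

section \<open>Reflection of Brownian motion\<close>

theorem theorem3p1:
  fixes M :: "'a measure" and B :: "real \<Rightarrow> 'a \<Rightarrow> real" and l K x v :: real
  assumes "standard_brownian_motion M B"
    and "l > 0" and "K > 0" and "x \<in> {0..l}"
  shows "\<exists>L0 Ll :: real \<Rightarrow> 'a \<Rightarrow> real.
    (\<forall>t\<ge>0. L0 t \<in> borel_measurable M) \<and>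
    (\<forall>t\<ge>0. Ll t \<in> borel_measurable M) \<and>
    (AE \<omega> in M.
       reflection_solution l K x v (\<lambda>t. B t \<omega>) (\<lambda>t. L0 t \<omega>) (\<lambda>t. Ll t \<omega>) \<and>
       (\<forall>f g. reflection_solution l K x v (\<lambda>t. B t \<omega>) f g \<longrightarrow>
          (\<forall>t\<ge>0. f t = L0 t \<omega> \<and> g t = Ll t \<omega>)))"
proof -
  define W where "W = (\<lambda>t \<omega>. x + B t \<omega> - v * t)"
  define L0 Ll where "L0 = (\<lambda>t \<omega>. skorokhod_lower l K (\<lambda>s. W s \<omega>) t)"
    and "Ll = (\<lambda>t \<omega>. skorokhod_upper l K (\<lambda>s. W s \<omega>) t)"
  have W: "W t \<in> borel_measurable M" if "t \<ge> 0" for t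
  proof -
    have [measurable]: "B t \<in> borel_measurable M"
      using assms(1) that by (simp add: standard_brownian_motion_def)
    show ?thesis unfolding W_def by measurable
  qed
  have "L0 t \<in> borel_measurable M" "Ll t \<in> borel_measurable M" for t
    using euler_measurable[of W M, OF W]
    unfolding L0_def Ll_def skorokhod_lower_def skorokhod_upper_def
    by (auto intro!: borel_measurable_lim_metric)
  moreover have "AE \<omega> in M.
       reflection_solution l K x v (\<lambda>t. B t \<omega>) (\<lambda>t. L0 t \<omega>) (\<lambda>t. Ll t \<omega>) \<and>
       (\<forall>f g. reflection_solution l K x v (\<lambda>t. B t \<omega>) f g \<longrightarrow>
          (\<forall>t\<ge>0. f t = L0 t \<omega> \<and> g t = Ll t \<omega>))"
  proof -
    have "AE \<omega> in M. B 0 \<omega> = 0" "AE \<omega> in M. continuous_on {0..} (\<lambda>t. B t \<omega>)"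
      using assms(1) by (simp_all add: standard_brownian_motion_def)
    then show ?thesis
    proof eventually_elim
      case (elim \<omega>)
      interpret feedback_driver l K "\<lambda>t. W t \<omega>"
        by unfold_locales (use elim assms in \<open>auto simp: W_def intro!: continuous_intros\<close>)
      show ?case
        unfolding reflection_solution_iff_feedback_solution[OF elim(2)] L0_def Ll_def
        using feedback_solution_exists feedback_solution_unique unfolding W_def by blast
    qed
  qed
  ultimately show ?thesis by blast
qed

end
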